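(* Let $\alpha,\beta\in\mathbb{Z}$ be such that the planet dance $\mathcal{P}(\alpha,\beta)$ is in reduced form, let $a\in\mathbb{Z}$, and let $m=|\alpha a-\beta|$, assumed to be positive. Then the modular stitch graph $\mathcal{M}(m,a)$ is the $m$-sampling of $\mathcal{P}(\alpha,\beta)$, i.e. $\mathcal{M}(m,a)=\mathcal{S}_m(\alpha,\beta)$ as sets of directed chords.
   Context: A directed chord of the unit circle in $\mathbb{C}$ (degenerate chords allowed) with initial point $e^{2\pi i x}$ and terminal point $e^{2\pi i y}$ is identified with the point $(x,y)\in\mathbb{R}^2/\mathbb{Z}^2$. For a positive integer $m$ and an integer $a$, the modular stitch graph $\mathcal{M}(m,a)$ is the set of directed chords with initial point $e^{2\pi i k/m}$ and terminal point $e^{2\pi i a k/m}$ for $k\in\{0,\dots,m-1\}$. For integers $\alpha,\beta$, the planet dance $\mathcal{P}(\alpha,\beta)$ is the set of directed chords with initial point $e^{2\pi i\alpha t}$ and terminal point $e^{2\pi i\beta t}$, $t\in[0,1]$. It is in reduced form if $(\alpha,\beta)\in\{(0,0),(0,1),(1,0)\}$ or $\gcd(\alpha,\beta)=1$. For a positive integer $m$, the $m$-sampling $\mathcal{S}_m(\alpha,\beta)$ of $\mathcal{P}(\alpha,\beta)$ is the finite set of its chords at $t=0,\frac1m,\dots,\frac{m-1}{m}$, i.e. $\mathcal{S}_m(\alpha,\beta)=\{(\frac{\alpha k}{m},\frac{\beta k}{m}): 0\le k<m\}\subset\mathbb{R}^2/\mathbb{Z}^2$. *)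

theory Defs
  imports Complex_Main
begin

definition circle_point :: "real \<Rightarrow> complex" where
  "circle_point x = exp (2 * of_real pi * \<i> * of_real x)"

text \<open>A directed chord is the ordered pair (initial point, terminal point) of points of the
  unit circle; the two points may coincide.  The chord with coordinates \<open>(x, y)\<close> depends only on
  the class of \<open>(x, y)\<close> modulo integer translations, and determines this class; see
  \<open>chord_eq_iff\<close> below.\<close>

type_synonym directed_chord = "complex \<times> complex"

definition chord :: "real \<Rightarrow> real \<Rightarrow> directed_chord" where
  "chord x y = (circle_point x, circle_point y)"

definition modular_stitch_graph :: "nat \<Rightarrow> int \<Rightarrow> directed_chord set" where
  "modular_stitch_graph m a =
     {chord (real k / real m) (real_of_int a * real k / real m) | k. k < m}"

definition planet_chord :: "int \<Rightarrow> int \<Rightarrow> real \<Rightarrow> directed_chord" where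
  "planet_chord \<alpha> \<beta> t = chord (real_of_int \<alpha> * t) (real_of_int \<beta> * t)"

definition planet_dance :: "int \<Rightarrow> int \<Rightarrow> directed_chord set" where
  "planet_dance \<alpha> \<beta> = planet_chord \<alpha> \<beta> ` {0..1}"

text \<open>Being in reduced form and the sampling refer to the presentation of a planet dance
  by \<open>(\<alpha>, \<beta>)\<close>, not only to its set of chords, hence both take \<open>\<alpha>\<close> and \<open>\<beta>\<close> as arguments.\<close>

definition in_reduced_form :: "int \<Rightarrow> int \<Rightarrow> bool" where
  "in_reduced_form \<alpha> \<beta> \<longleftrightarrow> (\<alpha>, \<beta>) \<in> {(0, 0), (0, 1), (1, 0)} \<or> gcd \<alpha> \<beta> = 1"

definition sampling :: "nat \<Rightarrow> int \<Rightarrow> int \<Rightarrow> directed_chord set" where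
  "sampling m \<alpha> \<beta> = {planet_chord \<alpha> \<beta> (real k / real m) | k. k < m}"

lemma circle_point_conv_cis: "circle_point x = cis (2 * pi * x)"
  by (simp add: circle_point_def cis_conv_exp mult_ac)

lemma norm_circle_point [simp]: "norm (circle_point x) = 1"
  by (simp add: circle_point_conv_cis)

lemma circle_point_eq_iff: "circle_point x = circle_point y \<longleftrightarrow> x - y \<in> \<int>"
proof -
  have "circle_point x = circle_point y \<longleftrightarrow> cis (2 * pi * (x - y)) = 1"
    by (simp add: circle_point_conv_cis right_diff_distrib flip: cis_divide)
  also have "\<dots> \<longleftrightarrow> cos (2 * pi * (x - y)) = 1"
    by (auto simp: complex_eq_iff dest: cos_one_sin_zero)
  also have "\<dots> \<longleftrightarrow> (\<exists>n::int. 2 * pi * (x - y) = of_int n * 2 * pi)"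
    by (simp add: cos_one_2pi_int)
  also have "\<dots> \<longleftrightarrow> x - y \<in> \<int>"
    by (auto simp: Ints_def)
  finally show ?thesis .
qed

lemma chord_eq_iff: "chord x y = chord x' y' \<longleftrightarrow> x - x' \<in> \<int> \<and> y - y' \<in> \<int>"
  by (simp add: chord_def circle_point_eq_iff)

lemma sampling_altdef:
  "sampling m \<alpha> \<beta> =
     {chord (real_of_int \<alpha> * real k / real m) (real_of_int \<beta> * real k / real m) | k. k < m}"
  by (simp add: sampling_def planet_chord_def)

lemma sampling_subset_planet_dance: "sampling m \<alpha> \<beta> \<subseteq> planet_dance \<alpha> \<beta>"
  by (auto simp: sampling_def planet_dance_def intro!: imageI)

end

theory Submission
  imports Defs "HOL-Number_Theory.Cong"
begin

text \<open>Since \<open>\<beta> \<equiv> \<alpha> a\<close> modulo \<open>m\<close>, the \<open>k\<close>-th chord of the sampling is the chord of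
  the modular stitch graph with index \<open>\<alpha> k\<close> modulo \<open>m\<close>.  Moreover \<open>gcd \<alpha> m = gcd \<alpha> \<beta> = 1\<close>, so
  \<open>\<alpha>\<close> is invertible modulo \<open>m\<close> and every chord of the graph is reached.\<close>

lemma cong_imp_diff_divide_Ints:
  fixes i j m :: int
  assumes "[i = j] (mod m)"
  shows "real_of_int i / real_of_int m - real_of_int j / real_of_int m \<in> \<int>"
proof -
  obtain c where "i - j = m * c"
    using assms by (auto simp: cong_iff_dvd_diff dvd_def)
  then have "real_of_int i - real_of_int j = real_of_int m * real_of_int c"
    by (metis of_int_diff of_int_mult)
  then show ?thesis
    \<comment> \<open>For \<open>m = 0\<close> both quotients are 0 by the convention
      \<open>x / 0 = 0\<close>; otherwise their difference is the integer \<open>c\<close>.\<close>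
    by (cases "m = 0") (simp_all flip: diff_divide_distrib)
qed

lemma chord_divide_eqI:
  fixes i i' j j' :: int and m :: nat
  assumes "[i = i'] (mod int m)" and "[j = j'] (mod int m)"
  shows "chord (real_of_int i / real m) (real_of_int j / real m) =
         chord (real_of_int i' / real m) (real_of_int j' / real m)"
  using assms[THEN cong_imp_diff_divide_Ints] by (simp add: chord_eq_iff)

text \<open>Multiplying the congruence for \<open>k\<close> by \<open>a\<close> and replacing
  \<alpha> \<open>* a\<close> by \<beta> makes the terminal points agree as well. Both inclusions
  rest on this matching of indices.\<close>

lemma stitch_chord_eq_planet_chord:
  fixes \<alpha> \<beta> a :: int and m k l :: nat
  assumes "[\<beta> = \<alpha> * a] (mod int m)" and kl: "[int k = \<alpha> * int l] (mod int m)"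
  shows "chord (real k / real m) (real_of_int a * real k / real m) =
         planet_chord \<alpha> \<beta> (real l / real m)"
proof -
  have "[a * int k = a * (\<alpha> * int l)] (mod int m)"
    using kl by (rule cong_scalar_left)
  also have "a * (\<alpha> * int l) = \<alpha> * a * int l"
    by simp
  also have "[\<alpha> * a * int l = \<beta> * int l] (mod int m)"
    using cong_scalar_right[OF cong_sym[OF assms(1)]] .
  finally have "[a * int k = \<beta> * int l] (mod int m)" .
  then show ?thesis
    using chord_divide_eqI[OF kl, of "a * int k" "\<beta> * int l"] by (simp add: planet_chord_def)
qed

lemma ex_nat_less_cong:
  fixes x :: int and m :: nat
  assumes "m > 0"
  shows "\<exists>k<m. [int k = x] (mod int m)"
  using assms by (intro exI[of _ "nat (x mod int m)"]) (simp add: cong_def nat_less_iff)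

theorem proposition3p4:
  fixes \<alpha> \<beta> a :: int and m :: nat
  assumes "in_reduced_form \<alpha> \<beta>"
    and "int m = \<bar>\<alpha> * a - \<beta>\<bar>"
    and "m > 0"
  shows "modular_stitch_graph m a = sampling m \<alpha> \<beta>"
proof (intro equalityI subsetI)
  have "[\<alpha> * a = \<beta>] (mod int m)"
    by (simp add: assms(2) cong_iff_dvd_diff)
  then have \<beta>: "[\<beta> = \<alpha> * a] (mod int m)"
    by (rule cong_sym)
  {
    fix c assume "c \<in> modular_stitch_graph m a"
    then obtain k where c: "c = chord (real k / real m) (real_of_int a * real k / real m)"
      by (auto simp: modular_stitch_graph_def)
    \<comment> \<open>Reduced form also admits (0, 0), but there \<bar>\<alpha> \<open>* a\<close> -
      \<beta>\<bar> would be 0, against \<open>m > 0\<close>. The other two exceptional pairs have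
      gcd 1.\<close>
    have "coprime \<alpha> \<beta>"
      using assms by (auto simp: in_reduced_form_def coprime_iff_gcd_eq_1)
    then have "coprime \<alpha> (\<alpha> * a - \<beta>)"
      using gcd_add_mult[of \<alpha> a "- \<beta>"] by (simp add: coprime_iff_gcd_eq_1 mult.commute)
    then have "coprime \<alpha> (int m)"
      by (simp add: assms(2))
    then obtain u where u: "[\<alpha> * u = 1] (mod int m)"
      using cong_solve_coprime_int by blast
    \<comment> \<open>Since \<open>u\<close> inverts \<alpha> modulo \<open>m\<close>, this choice
      solves \<alpha> \<open>* l\<close> \<equiv> \<open>k\<close>; reducing modulo \<open>m\<close>
      keeps \<open>l\<close> in the sampling range.\<close>
    obtain l where "l < m" and l: "[int l = u * int k] (mod int m)"
      using ex_nat_less_cong[OF \<open>m > 0\<close>] by blast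
    have "[\<alpha> * int l = \<alpha> * u * int k] (mod int m)"
      using cong_scalar_left[OF l, of \<alpha>] by (simp add: mult.assoc)
    also have "[\<alpha> * u * int k = int k] (mod int m)"
      using cong_scalar_right[OF u, of "int k"] by simp
    finally have "c = planet_chord \<alpha> \<beta> (real l / real m)"
      unfolding c by (rule stitch_chord_eq_planet_chord[OF \<beta> cong_sym])
    then show "c \<in> sampling m \<alpha> \<beta>"
      using \<open>l < m\<close> by (auto simp: sampling_def)
  next
    fix c assume "c \<in> sampling m \<alpha> \<beta>"
    then obtain l where c: "c = planet_chord \<alpha> \<beta> (real l / real m)"
      by (auto simp: sampling_def)
    \<comment> \<open>This direction only reduces \<alpha> \<open>* l\<close> modulo
      \<open>m\<close>; no inverse is taken.\<close>
    obtain k where "k < m" and "[int k = \<alpha> * int l] (mod int m)"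
      using ex_nat_less_cong[OF \<open>m > 0\<close>] by blast
    then show "c \<in> modular_stitch_graph m a"
      unfolding c modular_stitch_graph_def
      using stitch_chord_eq_planet_chord[OF \<beta>, symmetric] by blast
  }
qed

end
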